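(* For any integer $m\geq 2$, the curve in $\mathbb{P}^2$ $$C':\ F'=(x^my^m+y^mz^m+x^mz^m)(x^m+y^m)(y^m+z^m)=0$$ has degree $4m$ and is free with exponents $(2m-1,2m)$, and the curve $$C'':\ F''=yz(x^my^m+y^mz^m+x^mz^m)(y^m+z^m)=0$$ has degree $3m+2$ and is free with exponents $(m+1,2m)$.
   Context: Let $S=\mathbb{C}[x,y,z]$. For a reduced plane curve $G=0$ in $\mathbb{P}^2$ with $G\in S$ homogeneous, let $D_0(G)=\{a\partial_x+b\partial_y+c\partial_z : a,b,c\in S,\ aG_x+bG_y+cG_z=0\}$, a graded $S$-module of rank 2 (a derivation has degree $r$ if $a,b,c$ are homogeneous of degree $r$). The curve $G=0$ is free if $D_0(G)$ is a free graded $S$-module; its exponents $(d_1,d_2)$ are then the degrees of the elements of a homogeneous basis of $D_0(G)$. *)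

theory Defs
  imports
    Complex_Main
    "HOL-Library.Product_Plus"
    "HOL-Computational_Algebra.Computational_Algebra"
begin

text \<open>
  The ring \<open>S = \<complex>[x,y,z]\<close> is represented as \<open>\<complex>[x][y][z]\<close>: the innermost indeterminate is
  \<open>x\<close> and the outermost one is \<open>z\<close>. The coefficient of \<open>x^i y^j z^k\<close> in \<open>p\<close> is therefore
  \<open>coeff (coeff (coeff p k) j) i\<close>.
\<close>

type_synonym S = "complex poly poly poly"

definition varX :: S where "varX = [:[:[:0, 1:]:]:]"
definition varY :: S where "varY = [:[:0, 1:]:]"
definition varZ :: S where "varZ = [:0, 1:]"

definition partial_x :: "S \<Rightarrow> S" where "partial_x = map_poly (map_poly pderiv)"
definition partial_y :: "S \<Rightarrow> S" where "partial_y = map_poly pderiv"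
definition partial_z :: "S \<Rightarrow> S" where "partial_z = pderiv"

lemma coeff_partial_x:
  "coeff (coeff (coeff (partial_x p) k) j) i = of_nat (Suc i) * coeff (coeff (coeff p k) j) (Suc i)"
  by (simp add: partial_x_def coeff_map_poly coeff_pderiv)

lemma coeff_partial_y:
  "coeff (coeff (coeff (partial_y p) k) j) i = of_nat (Suc j) * coeff (coeff (coeff p k) (Suc j)) i"
proof -
  have "of_nat (Suc j) * q = smult (of_nat (Suc j)) q" for q :: "complex poly"
    by (metis of_nat_poly smult_0_right mult_pCons_left add.right_neutral mult_zero_left pCons_0_0)
  then show ?thesis
    by (simp only: partial_y_def coeff_map_poly pderiv_0 coeff_pderiv coeff_smult)
qed

lemma coeff_monomial:
  "coeff (coeff (coeff (varX ^ a * varY ^ b * varZ ^ c) k) j) i =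
    (if i = a \<and> j = b \<and> k = c then 1 else 0)"
proof -
  have X: "varX = monom (monom (monom 1 1) 0) 0" and Y: "varY = monom (monom 1 1) 0"
    and Z: "varZ = monom 1 1"
    by (simp_all add: varX_def varY_def varZ_def monom_0 monom_Suc)
  have "varX ^ a * varY ^ b * varZ ^ c = monom (monom (monom 1 a) b) c"
    by (simp only: X Y Z monom_power mult_monom) simp
  then show ?thesis by simp
qed

text \<open>The zero polynomial is homogeneous of every degree.\<close>

definition homogeneous :: "nat \<Rightarrow> S \<Rightarrow> bool" where
  "homogeneous d p \<longleftrightarrow> (\<forall>i j k. coeff (coeff (coeff p k) j) i \<noteq> 0 \<longrightarrow> i + j + k = d)"

text \<open>
  \<open>G = 0\<close> is a reduced plane curve of degree \<open>d\<close>; squarefreeness of \<open>G\<close> expresses that the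
  curve is reduced, and it entails \<open>G \<noteq> 0\<close>.
\<close>

definition reduced_plane_curve :: "S \<Rightarrow> nat \<Rightarrow> bool" where
  "reduced_plane_curve G d \<longleftrightarrow> d > 0 \<and> homogeneous d G \<and> squarefree G"

text \<open>
  The derivation \<open>a \<partial>\<^sub>x + b \<partial>\<^sub>y + c \<partial>\<^sub>z\<close> is represented by the triple \<open>(a, b, c)\<close>.
\<close>

type_synonym derivation = "S \<times> S \<times> S"

fun scale_der :: "S \<Rightarrow> derivation \<Rightarrow> derivation" where
  "scale_der f (a, b, c) = (f * a, f * b, f * c)"

interpretation der: module scale_der
  by unfold_locales (auto simp: algebra_simps)

fun der_homogeneous :: "nat \<Rightarrow> derivation \<Rightarrow> bool" where
  "der_homogeneous r (a, b, c) \<longleftrightarrow> homogeneous r a \<and> homogeneous r b \<and> homogeneous r c"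

definition D0 :: "S \<Rightarrow> derivation set" where
  "D0 G = {(a, b, c). a * partial_x G + b * partial_y G + c * partial_z G = 0}"

lemma subspace_D0: "der.subspace (D0 G)"
  unfolding der.subspace_def
proof (intro conjI ballI allI)
  show "0 \<in> D0 G" by (simp add: D0_def zero_prod_def)
next
  fix x y assume "x \<in> D0 G" "y \<in> D0 G"
  then show "x + y \<in> D0 G"
    by (auto simp: D0_def algebra_simps)
next
  fix f x assume "x \<in> D0 G"
  then show "scale_der f x \<in> D0 G"
    by (cases x) (simp add: D0_def mult.assoc flip: distrib_left)
qed

definition homogeneous_basis :: "S \<Rightarrow> derivation set \<Rightarrow> bool" where
  "homogeneous_basis G B \<longleftrightarrow>
    der.independent B \<and> der.span B = D0 G \<and> (\<forall>\<delta>\<in>B. \<exists>r. der_homogeneous r \<delta>)"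

text \<open>A graded module is free as a graded module iff it has a basis of homogeneous elements.\<close>

definition free_curve :: "S \<Rightarrow> bool" where
  "free_curve G \<longleftrightarrow> (\<exists>B. homogeneous_basis G B)"

definition exponents :: "S \<Rightarrow> nat \<Rightarrow> nat \<Rightarrow> bool" where
  "exponents G d1 d2 \<longleftrightarrow>
    (\<exists>\<delta>1 \<delta>2. \<delta>1 \<noteq> \<delta>2 \<and> homogeneous_basis G {\<delta>1, \<delta>2} \<and>
      der_homogeneous d1 \<delta>1 \<and> der_homogeneous d2 \<delta>2)"

definition F' :: "nat \<Rightarrow> S" where
  "F' m = (varX ^ m * varY ^ m + varY ^ m * varZ ^ m + varX ^ m * varZ ^ m) *
          (varX ^ m + varY ^ m) * (varY ^ m + varZ ^ m)"

definition F'' :: "nat \<Rightarrow> S" where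
  "F'' m = varY * varZ * (varX ^ m * varY ^ m + varY ^ m * varZ ^ m + varX ^ m * varZ ^ m) *
           (varY ^ m + varZ ^ m)"

end

theory Submission
  imports Defs "HOL-Computational_Algebra.Field_as_Ring"
begin

text \<open>
  Saito's criterion: if the partial derivatives of \<open>G\<close> have no common factor and the cross product
  of two derivations in \<open>D\<^sub>0(G)\<close> is a unit multiple of \<open>\<nabla>G\<close>, then they form a basis. The absence
  of a common factor also makes \<open>G\<close> squarefree. The two bases are guessed in the coordinates
  \<open>X = x^m\<close>, \<open>Y = y^m\<close>, \<open>Z = z^m\<close>. With \<open>u = X + Y\<close> and \<open>v = Y + Z\<close> the conic is \<open>uv - Y\<^sup>2\<close>, so \<open>F'\<close>
  becomes \<open>uv(uv - Y\<^sup>2)\<close>, which is killed by \<open>u \<partial>\<^sub>u - v \<partial>\<^sub>v\<close>. The pullback of \<open>\<partial>\<^sub>X\<close> is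
  \<open>x^(1-m) \<partial>\<^sub>x / m\<close>, so a field in \<open>X, Y, Z\<close> has to be multiplied by the power \<open>m - 1\<close> of each of
  \<open>x, y, z\<close> whose coordinate line it does not preserve; this is where the factors \<open>x^(m-1)\<close>,
  \<open>y^(m-1)\<close>, \<open>z^(m-1)\<close> come from.
\<close>

section \<open>Partial derivatives\<close>

lemma map_poly_add:
  assumes "\<And>a b. D (a + b) = D a + D b" "D 0 = 0"
  shows "map_poly D (p + q) = map_poly D p + map_poly D q"
  using assms by (intro poly_eqI) (simp add: coeff_map_poly)

text \<open>Coefficients of a product are finite convolution sums, so additivity and the product
  rule of \<open>D\<close> pass through them. Needed for \<open>partial_y\<close> and, nested, for
  \<open>partial_x\<close>.\<close>

lemma map_poly_leibniz:
  fixes D :: "'a::comm_semiring_1 \<Rightarrow> 'a"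
  assumes add: "\<And>a b. D (a + b) = D a + D b" and D0: "D 0 = 0"
    and leibniz: "\<And>a b. D (a * b) = D a * b + a * D b"
  shows "map_poly D (p * q) = map_poly D p * q + p * map_poly D q"
proof (rule poly_eqI)
  fix n
  have sum: "D (\<Sum>i\<in>A. f i) = (\<Sum>i\<in>A. D (f i))" for f :: "nat \<Rightarrow> 'a" and A
    by (induction A rule: infinite_finite_induct) (simp_all add: D0 add)
  show "coeff (map_poly D (p * q)) n = coeff (map_poly D p * q + p * map_poly D q) n"
    by (simp add: coeff_map_poly D0 coeff_mult sum leibniz sum.distrib)
qed

lemma leibniz_power:
  fixes D :: "'a::comm_ring_1 \<Rightarrow> 'a"
  assumes leibniz: "\<And>a b. D (a * b) = D a * b + a * D b"
  shows "D (a ^ Suc n) = of_nat (Suc n) * a ^ n * D a"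
proof (induction n)
  case (Suc n)
  have "D (a ^ Suc (Suc n)) = D a * a ^ Suc n + a * D (a ^ Suc n)"
    by (simp only: power_Suc[of a "Suc n"] leibniz)
  then show ?case
    unfolding Suc by (simp add: algebra_simps)
qed simp

lemma partial_add:
  "partial_x (p + q) = partial_x p + partial_x q"
  "partial_y (p + q) = partial_y p + partial_y q"
  "partial_z (p + q) = partial_z p + partial_z q"
  by (simp_all add: partial_x_def partial_y_def partial_z_def map_poly_add pderiv_add)

lemma partial_mult:
  "partial_x (p * q) = partial_x p * q + p * partial_x q"
  "partial_y (p * q) = partial_y p * q + p * partial_y q"
  "partial_z (p * q) = partial_z p * q + p * partial_z q"
  by (simp_all add: partial_x_def partial_y_def partial_z_def map_poly_add map_poly_leibniz
      pderiv_add pderiv_mult algebra_simps)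

lemmas partial_power =
  leibniz_power[of partial_x, OF partial_mult(1)]
  leibniz_power[of partial_y, OF partial_mult(2)]
  leibniz_power[of partial_z, OF partial_mult(3)]

lemma partial_var:
  "partial_x varX = 1" "partial_x varY = 0" "partial_x varZ = 0"
  "partial_y varX = 0" "partial_y varY = 1" "partial_y varZ = 0"
  "partial_z varX = 0" "partial_z varY = 0" "partial_z varZ = 1"
  by (simp_all add: partial_x_def partial_y_def partial_z_def varX_def varY_def varZ_def
      map_poly_pCons pderiv_pCons one_pCons)

lemmas partial_simps = partial_add partial_mult partial_power partial_var

section \<open>Homogeneous polynomials\<close>

lemma homogeneous_add: "homogeneous d p \<Longrightarrow> homogeneous d q \<Longrightarrow> homogeneous d (p + q)"
  unfolding homogeneous_def by (metis add_0 coeff_add)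

lemma homogeneous_minus: "homogeneous d p \<Longrightarrow> homogeneous d (- p)"
  unfolding homogeneous_def by simp

lemma homogeneous_diff: "homogeneous d p \<Longrightarrow> homogeneous d q \<Longrightarrow> homogeneous d (p - q)"
  using homogeneous_add[of d p "- q"] homogeneous_minus by simp

lemma homogeneous_mult:
  assumes p: "homogeneous d p" and q: "homogeneous e q"
  shows "homogeneous (d + e) (p * q)"
  unfolding homogeneous_def
proof (intro allI impI)
  fix i j k
  assume "coeff (coeff (coeff (p * q) k) j) i \<noteq> 0"
  then have "(\<Sum>c\<le>k. \<Sum>b\<le>j. \<Sum>a\<le>i. coeff (coeff (coeff p c) b) a *
      coeff (coeff (coeff q (k - c)) (j - b)) (i - a)) \<noteq> 0"
    by (simp add: coeff_mult coeff_sum)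
  then obtain a b c where abc: "c \<le> k" "b \<le> j" "a \<le> i"
    and nz: "coeff (coeff (coeff p c) b) a * coeff (coeff (coeff q (k - c)) (j - b)) (i - a) \<noteq> 0"
    by (metis (no_types, lifting) atMost_iff sum.not_neutral_contains_not_neutral)
  have "a + b + c = d" "(i - a) + (j - b) + (k - c) = e"
    using nz p q unfolding homogeneous_def by auto
  with abc show "i + j + k = d + e" by linarith
qed

lemma homogeneous_0: "homogeneous d 0"
  by (simp add: homogeneous_def)

lemma homogeneous_of_nat: "homogeneous 0 (of_nat n)"
  unfolding homogeneous_def of_nat_poly by (auto simp: coeff_pCons split: nat.splits)

lemma homogeneous_numeral: "homogeneous 0 (numeral n)"
  using homogeneous_of_nat[of "numeral n"] by simp

lemma homogeneous_var: "homogeneous 1 varX" "homogeneous 1 varY" "homogeneous 1 varZ"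
  unfolding homogeneous_def varX_def varY_def varZ_def
  by (auto simp: coeff_pCons split: nat.splits)

lemma homogeneous_power: "homogeneous d p \<Longrightarrow> homogeneous (n * d) (p ^ n)"
proof (induction n)
  case 0
  then show ?case using homogeneous_of_nat[of 1] by simp
next
  case (Suc n)
  then show ?case using homogeneous_mult[of d p "n * d" "p ^ n"] by simp
qed

lemma homogeneous_const_mult:
  "homogeneous d p \<Longrightarrow> homogeneous d (of_nat n * p)"
  "homogeneous d p \<Longrightarrow> homogeneous d (numeral w * p)"
  using homogeneous_mult[OF homogeneous_of_nat] homogeneous_mult[OF homogeneous_numeral] by simp_all

lemma homogeneous_var_power:
  "homogeneous n (varX ^ n)" "homogeneous n (varY ^ n)" "homogeneous n (varZ ^ n)"
  using homogeneous_var[THEN homogeneous_power, of n] by simp_all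

section \<open>Prime divisors\<close>

text \<open>Characteristic 0: no prime divides the numerical factors \<open>m\<close>,
  \<open>2\<close> and \<open>3 * m + 2\<close> that occur below.\<close>

lemma of_nat_S_unit: "n > 0 \<Longrightarrow> is_unit (of_nat n :: S)"
  by (simp add: of_nat_poly is_unit_const_poly_iff dvd_field_iff)

lemma prime_elem_not_dvd_of_nat: "prime_elem p \<Longrightarrow> n > 0 \<Longrightarrow> \<not> p dvd (of_nat n :: S)"
  using of_nat_S_unit by (meson dvd_trans prime_elem_not_unit)

lemma dvd_const_polyE:
  fixes c :: "'a::idom"
  assumes "p dvd [:c:]" "c \<noteq> 0"
  obtains a where "p = [:a:]" "a dvd c"
proof -
  have "degree p = 0"
    using dvd_imp_degree_le[OF assms(1)] assms(2) by simp
  then obtain a where "p = [:a:]" by (rule degree_eq_zeroE)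
  with assms(1) that show thesis by simp
qed

text \<open>If one variable is constant in the other, so is every divisor of it, and a constant
  dividing the other variable divides its coefficient 1. For \<open>x\<close> and \<open>y\<close>
  the variable \<open>z\<close> is stripped off first.\<close>

lemma common_divisor_var_unit:
  fixes p :: S
  shows "p dvd varX \<Longrightarrow> p dvd varY \<Longrightarrow> is_unit p"
    and "p dvd varX \<Longrightarrow> p dvd varZ \<Longrightarrow> is_unit p"
    and "p dvd varY \<Longrightarrow> p dvd varZ \<Longrightarrow> is_unit p"
proof -
  have const: "a dvd 1" if "[:a:] dvd [:0, 1:]" for a :: "'b::{comm_semiring_1,semiring_no_zero_divisors}"
    using that by (metis const_poly_dvd_iff coeff_pCons_0 coeff_pCons_Suc)
  show "is_unit p" if "p dvd varX" "p dvd varZ"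
    using that unfolding varX_def varZ_def
    by (elim dvd_const_polyE) (auto dest: const simp: is_unit_const_poly_iff)
  show "is_unit p" if "p dvd varY" "p dvd varZ"
    using that unfolding varY_def varZ_def
    by (elim dvd_const_polyE) (auto dest: const simp: is_unit_const_poly_iff)
  show "is_unit p" if "p dvd varX" "p dvd varY"
  proof -
    obtain a where a: "p = [:a:]" "a dvd [:[:0, 1:]:]"
      using \<open>p dvd varX\<close> unfolding varX_def by (elim dvd_const_polyE) auto
    then obtain b where b: "a = [:b:]"
      by (elim dvd_const_polyE) auto
    have "[:b:] dvd [:0, 1:]"
      using \<open>p dvd varY\<close> a b by (simp add: varY_def)
    then show ?thesis
      using a b const by (simp add: is_unit_const_poly_iff)
  qed
qed

text \<open>The first sum is free of \<open>z\<close>, hence so is \<open>p\<close>; thus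
  \<open>p\<close> divides the leading \<open>z\<close>-coefficient of the second sum, which is
  1.\<close>

lemma common_divisor_sums_unit:
  fixes p :: S
  assumes "p dvd varX ^ m + varY ^ m" "p dvd varY ^ m + varZ ^ m" "m > 0"
  shows "is_unit p"
proof -
  obtain n where n: "m = Suc n" using \<open>m > 0\<close> gr0_implies_Suc by auto
  have c: "varX ^ m + varY ^ m = [:[:[:0, 1:]:] ^ m + [:0, 1:] ^ m:]"
    by (simp add: varX_def varY_def poly_const_pow)
  \<comment> \<open>The coefficient of \<open>x^m\<close> shows that the sum is nonzero, without
    which a divisor of it need not be constant in \<open>z\<close>.\<close>
  have "coeff (coeff (coeff (varX ^ m + varY ^ m) 0) 0) m = 1"
    using coeff_monomial[of m 0 0 0 0 m] coeff_monomial[of 0 m 0 0 0 m] n by simp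
  then have "varX ^ m + varY ^ m \<noteq> 0"
    by (metis coeff_0 zero_neq_one)
  with assms(1) obtain a where a: "p = [:a:]"
    unfolding c by (elim dvd_const_polyE) auto
  have "varZ ^ m = monom 1 m"
    by (simp add: varZ_def monom_altdef)
  then have "coeff (varY ^ m + varZ ^ m) m = 1"
    by (simp add: n varY_def poly_const_pow del: power_Suc)
  moreover have "a dvd coeff (varY ^ m + varZ ^ m) m"
    using assms(2) a by (simp add: const_poly_dvd_iff)
  ultimately show ?thesis
    using a by (simp add: is_unit_const_poly_iff)
qed

section \<open>Saito's criterion\<close>

text \<open>As \<open>S\<close> is factorial, this makes the gcd of the partial derivatives a unit;
  primes suit a case distinction on the factors of explicit partials.
  \<open>partial_x G \<noteq> 0\<close> also permits cancellation.\<close>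

definition unit_gradient :: "S \<Rightarrow> bool" where
  "unit_gradient G \<longleftrightarrow> partial_x G \<noteq> 0 \<and>
     (\<forall>p. prime_elem p \<longrightarrow> p dvd partial_x G \<longrightarrow> p dvd partial_y G \<longrightarrow> \<not> p dvd partial_z G)"

lemma unit_gradientD:
  assumes "unit_gradient G" "d dvd partial_x G" "d dvd partial_y G" "d dvd partial_z G"
  shows "is_unit d"
proof (rule ccontr)
  assume "\<not> is_unit d"
  moreover have "d \<noteq> 0"
    using assms by (auto simp: unit_gradient_def)
  ultimately obtain p where "prime p" "p dvd d"
    using prime_divisor_exists by blast
  then show False
    using assms by (meson dvd_trans prime_imp_prime_elem unit_gradient_def)
qed

text \<open>By the product rule, a factor occurring twice in \<open>G\<close> divides all three
  partial derivatives.\<close>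

lemma unit_gradient_squarefree:
  assumes "unit_gradient G"
  shows "squarefree G"
proof (rule squarefreeI)
  fix d assume "d\<^sup>2 dvd G"
  then obtain q where "G = d * (d * q)"
    by (metis dvdE mult.assoc power2_eq_square)
  then have "d dvd partial_x G" "d dvd partial_y G" "d dvd partial_z G"
    by (simp_all add: partial_mult)
  with assms show "is_unit d"
    by (rule unit_gradientD)
qed

text \<open>Over the fraction field \<open>(u, v, w)\<close> is proportional to the gradient.
  Coprimality removes the denominator: \<open>partial_x G\<close> divides \<open>u\<close> times the
  gcd of the other two partials and is coprime to that gcd.\<close>

lemma parallel_gradient:
  assumes "unit_gradient G"
    and xy: "partial_x G * v = partial_y G * u" and xz: "partial_x G * w = partial_z G * u"
  obtains s where "u = s * partial_x G" "v = s * partial_y G" "w = s * partial_z G"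
proof -
  let ?x = "partial_x G" and ?y = "partial_y G" and ?z = "partial_z G"
  have nz: "?x \<noteq> 0" using assms by (simp add: unit_gradient_def)
  have "is_unit (gcd ?x (gcd ?y ?z))"
    by (rule unit_gradientD[OF assms(1)]) (meson dvd_trans gcd_dvd1 gcd_dvd2)+
  then have coprime: "coprime ?x (gcd ?y ?z)"
    by (simp add: coprime_iff_gcd_eq_1)
  have "?x dvd gcd (u * ?y) (u * ?z)"
    using xy xz by (metis dvd_triv_left gcd_greatest mult.commute)
  then have "?x dvd u * gcd ?y ?z"
    by (simp add: gcd_mult_left)
  then have "?x dvd u"
    using coprime by (simp add: coprime_dvd_mult_left_iff)
  then obtain s where s: "u = ?x * s"
    by (rule dvdE)
  have "?x * v = ?x * (s * ?y)" "?x * w = ?x * (s * ?z)"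
    using xy xz s by (simp_all add: mult_ac)
  then show thesis
    using that[of s] s nz by (simp add: mult.commute)
qed

text \<open>Elements of \<open>D0 G\<close> are orthogonal to the gradient, so the cross product of
  any two is a polynomial multiple of it. For a given \<open>\<delta>\<close>, the multiples
  obtained by crossing with the two fields are its coordinates up to the unit \<open>k\<close>, by
  Cramer's rule.\<close>

lemma saito_criterion:
  assumes grad: "unit_gradient G" and k: "is_unit k"
    and cx: "b1 * c2 - c1 * b2 = k * partial_x G"
    and cy: "c1 * a2 - a1 * c2 = k * partial_y G"
    and cz: "a1 * b2 - b1 * a2 = k * partial_z G"
    and hom: "der_homogeneous d1 (a1, b1, c1)" "der_homogeneous d2 (a2, b2, c2)"
  shows "homogeneous_basis G {(a1, b1, c1), (a2, b2, c2)} \<and> (a1, b1, c1) \<noteq> (a2, b2, c2)"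
proof -
  let ?x = "partial_x G" and ?y = "partial_y G" and ?z = "partial_z G"
  let ?\<delta>1 = "(a1, b1, c1)" and ?\<delta>2 = "(a2, b2, c2)"
  have nz: "?x \<noteq> 0" "k \<noteq> 0"
    using grad k by (auto simp: unit_gradient_def)
  have neq: "?\<delta>1 \<noteq> ?\<delta>2"
    using cx nz by auto
  \<comment> \<open>A cross product, here \<open>k\<close> times the gradient, is orthogonal to both
    of its factors.\<close>
  have "k * (a1 * ?x + b1 * ?y + c1 * ?z) = 0"
    using cx cy cz by algebra
  moreover have "k * (a2 * ?x + b2 * ?y + c2 * ?z) = 0"
    using cx cy cz by algebra
  ultimately have mem: "{?\<delta>1, ?\<delta>2} \<subseteq> D0 G"
    using nz by (auto simp: D0_def)
  have indep: "der.independent {?\<delta>1, ?\<delta>2}"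
  proof -
    have "r = 0 \<and> s = 0" if "scale_der r ?\<delta>1 + scale_der s ?\<delta>2 = 0" for r s
    proof -
      have e: "r * a1 + s * a2 = 0" "r * b1 + s * b2 = 0" "r * c1 + s * c2 = 0"
        using that by (simp_all add: zero_prod_def)
      \<comment> \<open>Crossing the relation with one field isolates the coefficient of the
        other.\<close>
      have "r * (k * ?x) = 0" "s * (k * ?x) = 0"
        using e unfolding cx[symmetric] by algebra+
      then show ?thesis using nz by simp
    qed
    then show ?thesis
      using neq by (subst der.dependent_finite) (auto simp del: scale_der.simps)
  qed
  have "\<delta> \<in> der.span {?\<delta>1, ?\<delta>2}" if "\<delta> \<in> D0 G" for \<delta>
  proof -
    obtain a b c where \<delta>: "\<delta> = (a, b, c)" by (cases \<delta>)
    with that have D: "a * ?x + b * ?y + c * ?z = 0" by (simp add: D0_def)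
    have D1: "a1 * ?x + b1 * ?y + c1 * ?z = 0" and D2: "a2 * ?x + b2 * ?y + c2 * ?z = 0"
      using mem by (simp_all add: D0_def)
    have "?x * (c * a2 - a * c2) = ?y * (b * c2 - c * b2)"
      "?x * (a * b2 - b * a2) = ?z * (b * c2 - c * b2)"
      using D D2 by algebra+
    then obtain s where s: "b * c2 - c * b2 = s * ?x" "c * a2 - a * c2 = s * ?y"
        "a * b2 - b * a2 = s * ?z"
      by (rule parallel_gradient[OF grad])
    have "?x * (c1 * a - a1 * c) = ?y * (b1 * c - c1 * b)"
      "?x * (a1 * b - b1 * a) = ?z * (b1 * c - c1 * b)"
      using D D1 by algebra+
    then obtain t where t: "b1 * c - c1 * b = t * ?x" "c1 * a - a1 * c = t * ?y"
        "a1 * b - b1 * a = t * ?z"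
      by (rule parallel_gradient[OF grad])
    \<comment> \<open>The triple product vanishes because \<open>\<delta>\<close> kills
      \<open>G\<close>. Cramer's rule below is an identity in the last two coordinates; only the
      first one uses this determinant.\<close>
    have "a * (b1 * c2 - c1 * b2) + b * (c1 * a2 - a1 * c2) + c * (a1 * b2 - b1 * a2)
        = k * (a * ?x + b * ?y + c * ?z)"
      unfolding cx cy cz by (simp add: algebra_simps)
    then have det: "a * (b1 * c2 - c1 * b2) + b * (c1 * a2 - a1 * c2) + c * (a1 * b2 - b1 * a2) = 0"
      by (simp add: D)
    have "?x * (s * a1 + t * a2) = (b * c2 - c * b2) * a1 + (b1 * c - c1 * b) * a2"
      "?x * (s * b1 + t * b2) = (b * c2 - c * b2) * b1 + (b1 * c - c1 * b) * b2"
      "?x * (s * c1 + t * c2) = (b * c2 - c * b2) * c1 + (b1 * c - c1 * b) * c2"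
      unfolding s t by (simp_all add: algebra_simps)
    moreover have "?x * (k * a) = (b1 * c2 - c1 * b2) * a"
      "?x * (k * b) = (b1 * c2 - c1 * b2) * b" "?x * (k * c) = (b1 * c2 - c1 * b2) * c"
      unfolding cx by (simp_all add: algebra_simps)
    ultimately have "?x * (k * a) = ?x * (s * a1 + t * a2)"
      "?x * (k * b) = ?x * (s * b1 + t * b2)"
      "?x * (k * c) = ?x * (s * c1 + t * c2)"
      using det by algebra+
    then have e: "k * a = s * a1 + t * a2" "k * b = s * b1 + t * b2" "k * c = s * c1 + t * c2"
      using nz by simp_all
    obtain l where l: "l * k = 1" using k by (metis dvdE mult.commute)
    have "\<delta> = scale_der l (k * a, k * b, k * c)"
      using l by (simp add: \<delta> mult.assoc[symmetric])
    also have "\<dots> = scale_der l (scale_der s ?\<delta>1 + scale_der t ?\<delta>2)"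
      by (simp add: e)
    finally show ?thesis
      by (metis der.span_add der.span_base der.span_scale insertCI)
  qed
  then have "der.span {?\<delta>1, ?\<delta>2} = D0 G"
    using der.span_minimal[OF mem subspace_D0] by blast
  with indep hom neq show ?thesis
    by (auto simp: homogeneous_basis_def simp del: der_homogeneous.simps)
qed

lemma curve_from_saito:
  assumes "unit_gradient G" "is_unit k"
    and "b1 * c2 - c1 * b2 = k * partial_x G"
    and "c1 * a2 - a1 * c2 = k * partial_y G"
    and "a1 * b2 - b1 * a2 = k * partial_z G"
    and "der_homogeneous d1 (a1, b1, c1)" "der_homogeneous d2 (a2, b2, c2)"
    and "homogeneous d G" "d > 0"
  shows "reduced_plane_curve G d \<and> free_curve G \<and> exponents G d1 d2"
  using saito_criterion[OF assms(1-7)] assms unit_gradient_squarefree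
  unfolding reduced_plane_curve_def free_curve_def exponents_def by blast


section \<open>The two curves\<close>

text \<open>\<open>F'\<close> is \<open>t * (t - Y * Y)\<close> at
  \<open>t = (X + Y) * (Y + Z)\<close>, and \<open>c\<close> is its derivative with respect to
  \<open>t\<close>.\<close>

lemma partials_F':
  fixes n :: nat
  defines "m \<equiv> Suc n"
  defines "X \<equiv> varX ^ m" and "Y \<equiv> varY ^ m" and "Z \<equiv> varZ ^ m"
  defines "c \<equiv> 2 * ((X + Y) * (Y + Z)) - Y * Y"
  shows "partial_x (F' m) = of_nat m * varX ^ n * (Y + Z) * c"
    and "partial_y (F' m) = of_nat m * varY ^ n * ((X + 2 * Y + Z) * c - Y * (2 * ((X + Y) * (Y + Z))))"
    and "partial_z (F' m) = of_nat m * varZ ^ n * (X + Y) * c"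
  unfolding F'_def assms partial_simps
  by (simp_all add: algebra_simps del: of_nat_Suc)

text \<open>The \<open>X\<close>-derivative of \<open>Q\<close> is \<open>Y + Z\<close>, whence the
  square in the first partial. The simple factors \<open>y\<close> and \<open>z\<close> absorb the
  powers \<open>y^n\<close> and \<open>z^n\<close> of the chain rule into \<open>Y\<close> and
  \<open>Z\<close>.\<close>

lemma partials_F'':
  fixes n :: nat
  defines "m \<equiv> Suc n"
  defines "X \<equiv> varX ^ m" and "Y \<equiv> varY ^ m" and "Z \<equiv> varZ ^ m"
  defines "Q \<equiv> X * Y + Y * Z + X * Z"
  shows "partial_x (F'' m) = of_nat m * varX ^ n * varY * varZ * (Y + Z) * (Y + Z)"
    and "partial_y (F'' m) = varZ * (Q * (Y + Z) + of_nat m * Y * (X + Z) * (Y + Z) + of_nat m * Y * Q)"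
    and "partial_z (F'' m) = varY * (Q * (Y + Z) + of_nat m * Z * (X + Y) * (Y + Z) + of_nat m * Z * Q)"
  unfolding F''_def assms partial_simps
  by (simp_all add: algebra_simps del: of_nat_Suc)

lemma homogeneous_F': "homogeneous (4 * m) (F' m)"
proof -
  have "homogeneous (m + m + m + m) (F' m)"
    unfolding F'_def by (intro homogeneous_mult homogeneous_add homogeneous_var_power)
  moreover have "m + m + m + m = 4 * m" by simp
  ultimately show ?thesis by metis
qed

lemma homogeneous_F'': "homogeneous (3 * m + 2) (F'' m)"
proof -
  have "homogeneous (1 + 1 + (m + m) + m) (F'' m)"
    unfolding F''_def
    by (intro homogeneous_mult homogeneous_add homogeneous_var_power homogeneous_var)
  moreover have "1 + 1 + (m + m) + m = 3 * m + 2" by simp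
  ultimately show ?thesis by metis
qed

section \<open>Coprimality of the partial derivatives\<close>

lemma eval_var:
  "poly varX c = [:[:0, 1:]:]" "poly varY c = [:0, 1:]" "poly varZ c = c"
  by (simp_all add: varX_def varY_def varZ_def)

lemma unit_gradient_F':
  assumes "m > 0"
  shows "unit_gradient (F' m)"
  unfolding unit_gradient_def
proof (intro conjI allI impI notI)
  define X where "X = varX ^ m"
  define Y where "Y = varY ^ m"
  define Z where "Z = varZ ^ m"
  define c where "c = 2 * ((X + Y) * (Y + Z)) - Y * Y"
  obtain n where n: "m = Suc n" using \<open>m > 0\<close> gr0_implies_Suc by auto
  note partials = partials_F'[of n, folded n, folded X_def Y_def Z_def, folded c_def]
  show False
    if p: "prime_elem p" "p dvd partial_x (F' m)" "p dvd partial_y (F' m)" "p dvd partial_z (F' m)"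
    for p
  proof -
    have X: "p dvd varX \<longleftrightarrow> p dvd X" and Y: "p dvd varY \<longleftrightarrow> p dvd Y" and Z: "p dvd varZ \<longleftrightarrow> p dvd Z"
      using p(1) \<open>m > 0\<close> by (simp_all add: X_def Y_def Z_def prime_elem_dvd_power_iff)
    have XY: "\<not> (p dvd X \<and> p dvd Y)" and XZ: "\<not> (p dvd X \<and> p dvd Z)"
      and YZ: "\<not> (p dvd Y \<and> p dvd Z)"
      using common_divisor_var_unit[of p] p(1) X Y Z prime_elem_not_unit by blast+
    have uv: "\<not> (p dvd X + Y \<and> p dvd Y + Z)"
      using common_divisor_sums_unit[of p m] \<open>m > 0\<close> p(1) prime_elem_not_unit
      unfolding X_def Y_def Z_def by blast
    have const: "\<not> p dvd of_nat m"
      using prime_elem_not_dvd_of_nat p(1) \<open>m > 0\<close> by blast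
    have power: "p dvd v ^ n \<Longrightarrow> p dvd v" for v
      using p(1) prime_elem_dvd_power by blast
    have x: "p dvd X \<or> p dvd Y + Z \<or> p dvd c"
      using p(1,2) const power X unfolding partials by (auto simp: prime_elem_dvd_mult_iff)
    have z: "p dvd Z \<or> p dvd X + Y \<or> p dvd c"
      using p(1,4) const power Z unfolding partials by (auto simp: prime_elem_dvd_mult_iff)
    show False
    proof (cases "p dvd c")
      case True
      \<comment> \<open>Modulo \<open>c\<close> this is \<open>Y * Y\<close>, so the
        \<open>y\<close>-partial forces \<open>p\<close> to divide \<open>Y\<close>. Modulo
        \<open>Y\<close> the two sums become \<open>X\<close> and \<open>Z\<close>, one of which
        \<open>p\<close> then divides as well.\<close>
      have eq: "2 * ((X + Y) * (Y + Z)) = c + Y * Y"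
        by (simp add: c_def)
      have "p dvd Y \<or> p dvd Y * (2 * ((X + Y) * (Y + Z)))"
        using p(1,3) const power Y True unfolding partials
        by (auto simp: prime_elem_dvd_mult_iff dvd_diff_right_iff)
      then have pY: "p dvd Y"
        using p(1) True unfolding eq by (auto simp: prime_elem_dvd_mult_iff dvd_add_right_iff)
      with True have "p dvd 2 * ((X + Y) * (Y + Z))"
        unfolding eq by simp
      moreover have "\<not> p dvd 2"
        using prime_elem_not_dvd_of_nat[of p 2] p(1) by simp
      ultimately have "p dvd X \<or> p dvd Z"
        using p(1) pY by (auto simp: prime_elem_dvd_mult_iff dvd_add_left_iff dvd_add_right_iff)
      then show False using pY XY YZ by blast
    next
      case False
      \<comment> \<open>Each of the four combinations makes \<open>p\<close> divide two of
        \<open>X\<close>, \<open>Y\<close>, \<open>Z\<close>, or both \<open>X + Y\<close> and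
        \<open>Y + Z\<close>.\<close>
      then show False
        using x z XY XZ YZ uv by (auto simp: dvd_add_left_iff dvd_add_right_iff)
    qed
  qed
  \<comment> \<open>The value at the point (1, 1, 1) is \<open>14 * m\<close>.\<close>
  have "poly (poly (poly (partial_x (F' m)) 1) 1) 1 \<noteq> 0"
    unfolding partials using \<open>m > 0\<close>
    by (simp add: eval_var X_def Y_def Z_def c_def)
  then show False if "partial_x (F' m) = 0"
    using that by simp
qed

lemma unit_gradient_F'':
  assumes "m > 0"
  shows "unit_gradient (F'' m)"
  unfolding unit_gradient_def
proof (intro conjI allI impI notI)
  define X where "X = varX ^ m"
  define Y where "Y = varY ^ m"
  define Z where "Z = varZ ^ m"
  define M :: S where "M = of_nat m"
  define Q where "Q = X * Y + Y * Z + X * Z"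
  obtain n where n: "m = Suc n" using \<open>m > 0\<close> gr0_implies_Suc by auto
  note partials = partials_F''[of n, folded n, folded X_def Y_def Z_def, folded Q_def M_def]
  show False
    if p: "prime_elem p" "p dvd partial_x (F'' m)" "p dvd partial_y (F'' m)" "p dvd partial_z (F'' m)"
    for p
  proof -
    have X: "p dvd varX \<longleftrightarrow> p dvd X" and Y: "p dvd varY \<longleftrightarrow> p dvd Y" and Z: "p dvd varZ \<longleftrightarrow> p dvd Z"
      using p(1) \<open>m > 0\<close> by (simp_all add: X_def Y_def Z_def prime_elem_dvd_power_iff)
    have XY: "\<not> (p dvd X \<and> p dvd Y)" and XZ: "\<not> (p dvd X \<and> p dvd Z)"
      and YZ: "\<not> (p dvd Y \<and> p dvd Z)"
      using common_divisor_var_unit[of p] p(1) X Y Z prime_elem_not_unit by blast+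
    have const: "\<not> p dvd M"
      using prime_elem_not_dvd_of_nat p(1) \<open>m > 0\<close> unfolding M_def by blast
    have power: "p dvd v ^ n \<Longrightarrow> p dvd v" for v
      using p(1) prime_elem_dvd_power by blast
    have x: "p dvd X \<or> p dvd Y \<or> p dvd Z \<or> p dvd Y + Z"
      using p(1,2) const power X Y Z unfolding partials by (auto simp: prime_elem_dvd_mult_iff)
    have y: "p dvd Z \<or> p dvd Q * (Y + Z) + M * Y * (X + Z) * (Y + Z) + M * Y * Q"
      using p(1,3) Z unfolding partials by (auto simp: prime_elem_dvd_mult_iff)
    have z: "p dvd Y \<or> p dvd Q * (Y + Z) + M * Z * (X + Y) * (Y + Z) + M * Z * Q"
      using p(1,4) Y unfolding partials by (auto simp: prime_elem_dvd_mult_iff)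
    \<comment> \<open>Reduced modulo the factor that \<open>p\<close> divides, one of the brackets
      in \<open>y\<close> and \<open>z\<close> is a monomial up to a unit; only the case of
      \<open>X\<close> needs both brackets.\<close>
    consider "p dvd Y" | "p dvd Z" | "p dvd X" "\<not> p dvd Y" "\<not> p dvd Z"
      | "p dvd Y + Z" "\<not> p dvd Y" "\<not> p dvd Z" using x by blast
    then show False
    proof cases
      case 1
      have "Q * (Y + Z) + M * Y * (X + Z) * (Y + Z) + M * Y * Q
          = Y * ((X + Z) * (Y + Z) + X * Z + M * (X + Z) * (Y + Z) + M * Q) + X * Z * Z"
        by (simp add: Q_def algebra_simps)
      with y 1 have "p dvd Z \<or> p dvd X * Z * Z"
        by (auto simp: dvd_add_right_iff)
      with p(1) 1 XY YZ show False by (auto simp: prime_elem_dvd_mult_iff)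
    next
      case 2
      have "Q * (Y + Z) + M * Z * (X + Y) * (Y + Z) + M * Z * Q
          = Z * ((X + Y) * (Y + Z) + X * Y + M * (X + Y) * (Y + Z) + M * Q) + X * Y * Y"
        by (simp add: Q_def algebra_simps)
      with z 2 have "p dvd Y \<or> p dvd X * Y * Y"
        by (auto simp: dvd_add_right_iff)
      with p(1) 2 XZ YZ show False by (auto simp: prime_elem_dvd_mult_iff)
    next
      case 3
      have "Q * (Y + Z) + M * Y * (X + Z) * (Y + Z) + M * Y * Q
          = X * ((Y + Z) * (Y + Z) + M * Y * (Y + Z) + M * Y * (Y + Z))
            + Y * Z * ((1 + 2 * M) * Y + (1 + M) * Z)"
        by (simp add: Q_def algebra_simps)
      with y 3 p(1) have a: "p dvd (1 + 2 * M) * Y + (1 + M) * Z"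
        by (auto simp: dvd_add_right_iff prime_elem_dvd_mult_iff)
      have "Q * (Y + Z) + M * Z * (X + Y) * (Y + Z) + M * Z * Q
          = X * ((Y + Z) * (Y + Z) + M * Z * (Y + Z) + M * Z * (Y + Z))
            + Y * Z * ((1 + M) * Y + (1 + 2 * M) * Z)"
        by (simp add: Q_def algebra_simps)
      with z 3 p(1) have b: "p dvd (1 + M) * Y + (1 + 2 * M) * Z"
        by (auto simp: dvd_add_right_iff prime_elem_dvd_mult_iff)
      \<comment> \<open>The multipliers eliminate \<open>Z\<close> from the two linear forms; the
        determinant \<open>(1 + 2 * M)\<^sup>2 - (1 + M)\<^sup>2 = M * (3 * M + 2)\<close> is a
        unit.\<close>
      have "p dvd (1 + 2 * M) * ((1 + 2 * M) * Y + (1 + M) * Z)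
          - (1 + M) * ((1 + M) * Y + (1 + 2 * M) * Z)"
        using a b by (intro dvd_diff dvd_mult)
      also have "\<dots> = M * of_nat (3 * m + 2) * Y"
        by (simp add: M_def algebra_simps)
      finally show False
        using 3 p(1) const prime_elem_not_dvd_of_nat[OF p(1), of "3 * m + 2"]
        by (auto simp: prime_elem_dvd_mult_iff simp del: of_nat_add of_nat_mult)
    next
      case 4
      have "Q * (Y + Z) + M * Y * (X + Z) * (Y + Z) + M * Y * Q
          = (Y + Z) * (Q + M * Y * (X + Z) + M * Y * X) + M * Y * Y * Z"
        by (simp add: Q_def algebra_simps)
      with y 4 have "p dvd M * Y * Y * Z"
        by (auto simp: dvd_add_right_iff)
      with p(1) 4 const show False by (auto simp: prime_elem_dvd_mult_iff)
    qed
  qed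
  have "poly (poly (poly (partial_x (F'' m)) 1) 1) 1 \<noteq> 0"
    unfolding partials using \<open>m > 0\<close>
    by (simp add: eval_var X_def Y_def Z_def M_def)
  then show False if "partial_x (F'' m) = 0"
    using that by simp
qed


section \<open>Explicit bases\<close>

lemma curve_F':
  assumes "m > 0"
  shows "reduced_plane_curve (F' m) (4 * m) \<and> free_curve (F' m) \<and>
    exponents (F' m) (2 * m - 1) (2 * m)"
proof -
  define X where "X = varX ^ m"
  define Y where "Y = varY ^ m"
  define Z where "Z = varZ ^ m"
  define M :: S where "M = of_nat m"
  obtain n where n: "m = Suc n" using \<open>m > 0\<close> gr0_implies_Suc by auto
  note partials = partials_F'[of n, folded n, folded X_def Y_def Z_def M_def]
  have Xn: "X = varX * varX ^ n" and Yn: "Y = varY * varY ^ n" and Zn: "Z = varZ * varZ ^ n"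
    by (simp_all add: X_def Y_def Z_def n)
  have hom: "homogeneous m X" "homogeneous m Y" "homogeneous m Z"
    unfolding X_def Y_def Z_def by (rule homogeneous_var_power)+
  have deg: "n + m = 2 * m - 1" "n + (1 + m) = 2 * m" "m + m = 2 * m"
    using n by simp_all
  have hom1: "homogeneous (n + m) (M * (varZ ^ n * (X + Y)))"
    "homogeneous (n + m) (- (M * (varX ^ n * (Y + Z))))"
    unfolding M_def by (intro homogeneous_minus homogeneous_const_mult homogeneous_mult
        homogeneous_add homogeneous_var_power hom)+
  have hom2: "homogeneous (n + (1 + m)) (- (varY ^ n * (varX * (2 * X + 3 * Y))))"
    "homogeneous (n + (1 + m)) (- (varY ^ n * (varZ * (2 * Z + 3 * Y))))"
    by (intro homogeneous_minus homogeneous_const_mult homogeneous_mult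
        homogeneous_add homogeneous_var_power homogeneous_var hom)+
  have hom3: "homogeneous (m + m) (Y * Y + 2 * (X * Y + Y * Z + X * Z))"
    by (intro homogeneous_const_mult homogeneous_mult homogeneous_add hom)
  show ?thesis
  proof (rule curve_from_saito[where k = 1])
    \<comment> \<open>The pullback of \<open>(X + Y) \<partial>_X - (Y + Z) \<partial>_Z\<close>,
      cleared of denominators by \<open>x^n\<close> and \<open>z^n\<close>; the factor
      \<open>M\<close> makes the cross product exactly the gradient.\<close>
    show "der_homogeneous (2 * m - 1)
        (M * (varZ ^ n * (X + Y)), 0, - (M * (varX ^ n * (Y + Z))))"
      using hom1 homogeneous_0 unfolding deg by simp
    \<comment> \<open>The first field has no \<open>\<partial>_y\<close> part, so the cross product
      forces the middle entry \<open>2 * (X + Y) * (Y + Z) - Y * Y\<close>. Up to the factor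
      \<open>m * y^n\<close>, this field multiplies \<open>X + Y\<close>, \<open>Y + Z\<close> and
      the conic by \<open>Y - 2 * X + 2 * Z\<close>, \<open>Y + 2 * X - 2 * Z\<close> and
      \<open>- 2 * Y\<close>, which add up to 0.\<close>
    show "der_homogeneous (2 * m)
        (- (varY ^ n * (varX * (2 * X + 3 * Y))), Y * Y + 2 * (X * Y + Y * Z + X * Z),
         - (varY ^ n * (varZ * (2 * Z + 3 * Y))))"
      using hom2 hom3 unfolding deg by simp
  qed (use assms unit_gradient_F' homogeneous_F' in
      \<open>simp_all add: partials Xn Yn Zn algebra_simps\<close>)
qed

lemma curve_F'':
  assumes "m > 0"
  shows "reduced_plane_curve (F'' m) (3 * m + 2) \<and> free_curve (F'' m) \<and>
    exponents (F'' m) (m + 1) (2 * m)"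
proof -
  define X where "X = varX ^ m"
  define Y where "Y = varY ^ m"
  define Z where "Z = varZ ^ m"
  define M :: S where "M = of_nat m"
  define Q where "Q = X * Y + Y * Z + X * Z"
  obtain n where n: "m = Suc n" using \<open>m > 0\<close> gr0_implies_Suc by auto
  note partials = partials_F''[of n, folded n, folded X_def Y_def Z_def M_def, folded Q_def]
  have Xn: "X = varX * varX ^ n"
    by (simp add: X_def n)
  have hom: "homogeneous m X" "homogeneous m Y" "homogeneous m Z"
    unfolding X_def Y_def Z_def by (rule homogeneous_var_power)+
  define r s k where "r = 1 + 2 * m" and "s = 1 + m" and "k = 2 + 3 * m"
  have rsk: "of_nat r = 1 + 2 * M" "of_nat s = 1 + M" "of_nat k = 2 + 3 * M"
    by (simp_all add: r_def s_def k_def M_def)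
  have deg: "n + (1 + m) = 2 * m" "m + m = 2 * m"
    using n by simp_all
  have hom1: "homogeneous (1 + m) (- (of_nat r * (varX * (Y - Z))))"
    "homogeneous (1 + m) (varY * (of_nat s * Y + of_nat r * Z))"
    "homogeneous (1 + m) (- (varZ * (of_nat r * Y + of_nat s * Z)))"
    by (intro homogeneous_minus homogeneous_const_mult homogeneous_mult
        homogeneous_add homogeneous_diff homogeneous_var hom)+
  have hom2: "homogeneous (m + m) (M * (X * (Y + Z)) - of_nat k * Q)"
    unfolding Q_def M_def
    by (intro homogeneous_const_mult homogeneous_mult homogeneous_diff homogeneous_add hom)
  have hom3: "homogeneous (n + (1 + m)) (M * (varX ^ n * (varY * (Y + Z))))"
    "homogeneous (n + (1 + m)) (M * (varX ^ n * (varZ * (Y + Z))))"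
    unfolding M_def by (intro homogeneous_const_mult homogeneous_mult
        homogeneous_add homogeneous_var_power homogeneous_var hom)+
  show ?thesis
  proof (rule curve_from_saito[where k = "of_nat k"])
    \<comment> \<open>All coordinate lines are preserved, so no extra powers enter. The field
      multiplies \<open>y * z\<close>, \<open>Y + Z\<close> and \<open>Q\<close> by
      \<open>- m\<close>, \<open>m * (1 + m)\<close> and \<open>- m\<^sup>2\<close> times
      \<open>Y - Z\<close>; the choice of \<open>r\<close> and \<open>s\<close> makes these
      cancel.\<close>
    show "der_homogeneous (m + 1)
        (- (of_nat r * (varX * (Y - Z))), varY * (of_nat s * Y + of_nat r * Z),
         - (varZ * (of_nat r * Y + of_nat s * Z)))"
      using hom1 by simp
    \<comment> \<open>\<open>M * x^n * (Y + Z)\<close> times the Euler field, which multiplies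
      \<open>F''\<close> by its degree \<open>k\<close>, corrected by
      \<open>k * Q * \<partial>_x\<close>; this works since
      \<open>Q * partial_x F'' = M * x^n * (Y + Z) * F''\<close>.\<close>
    show "der_homogeneous (2 * m)
        (M * (X * (Y + Z)) - of_nat k * Q, M * (varX ^ n * (varY * (Y + Z))),
         M * (varX ^ n * (varZ * (Y + Z))))"
      using hom2 hom3 unfolding deg by simp
    show "is_unit (of_nat k :: S)"
      by (rule of_nat_S_unit) (simp add: k_def)
  qed (use assms unit_gradient_F'' homogeneous_F'' in
      \<open>simp_all add: partials rsk Q_def Xn algebra_simps\<close>)
qed

theorem theorem1p8:
  fixes m :: nat
  assumes "m \<ge> 2"
  shows "(reduced_plane_curve (F' m) (4 * m) \<and>
          free_curve (F' m) \<and> exponents (F' m) (2 * m - 1) (2 * m)) \<and>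
         (reduced_plane_curve (F'' m) (3 * m + 2) \<and>
          free_curve (F'' m) \<and> exponents (F'' m) (m + 1) (2 * m))"
  using assms curve_F'[of m] curve_F''[of m] by simp

end
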